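(* Let $\mathcal{P}$ and $\mathcal{Q}$ be posets on disjoint finite sets $S$ and $T$, respectively. If $\eta\in\mathrm{NN}(\mathcal{P},q)$ and $\nu\in\mathrm{NN}(\mathcal{Q},q)$, then $$\mu_{\mathcal{P},\mathcal{Q}}(\kappa_\eta\otimes\kappa_\nu)=\sum_{\substack{\rho\in\mathrm{NN}(\mathcal{P}\cdot\mathcal{Q},q)\\ \rho|_S=\eta,\ \rho|_T=\nu}}\kappa_\rho.$$
   Context: $\mathbb{F}_q$ is the field with $q$ elements. For a poset $\mathcal{P}$ on a finite set $I$, the pattern group $U_\mathcal{P}$ is the group of matrices $g=1+x$, where $x=(x_{ij})_{i,j\in I}$ over $\mathbb{F}_q$ has $x_{ij}=0$ unless $i\prec_\mathcal{P}j$. An $(\mathbb{F}_q,\mathcal{P})$-set partition is a set $\eta$ of labeled arcs $i\overset{a}{\frown}j$ ($i,j\in I$, $a\in\mathbb{F}_q^\times$, at most one label for each pair) such that (1) $i\prec_\mathcal{P}j$ for every arc; (2) if $i\overset{a}{\frown}j\in\eta$ and $i\prec_\mathcal{P}k\prec_\mathcal{P}j$, then $\eta$ has no arc from $i$ to $k$ and none from $k$ to $j$ (with any label). It is nonnesting if there are no arcs $i\overset{a}{\frown}j,k\overset{b}{\frown}l\in\eta$ with $i\prec_\mathcal{P}k\prec_\mathcal{P}l\prec_\mathcal{P}j$. $\mathrm{NN}(\mathcal{P},q)$ is the set of nonnesting $(\mathbb{F}_q,\mathcal{P})$-set partitions. For $S\subseteq I$, $\eta|_S=\{i\overset{a}{\frown}j\in\eta\mid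 i,j\in S\}$. For $g\in U_\mathcal{P}$, $\mathrm{sml}(g)\in\mathrm{NN}(\mathcal{P},q)$ is the set of arcs $i\overset{g_{ij}}{\frown}j$ with $i\prec_\mathcal{P}j$, $g_{ij}\neq0$, and $g_{kl}=0$ whenever $(k,l)\neq(i,j)$ and $i\preceq_\mathcal{P}k\prec_\mathcal{P}l\preceq_\mathcal{P}j$. For $\eta\in\mathrm{NN}(\mathcal{P},q)$, $K_\eta=\{g\in U_\mathcal{P}\mid\mathrm{sml}(g)=\eta\}$ and $\kappa_\eta:U_\mathcal{P}\to\mathbb{C}$ is the indicator function of $K_\eta$. For posets $\mathcal{P}$ on $S$ and $\mathcal{Q}$ on $T$ ($S,T$ disjoint), $\mathcal{P}\cdot\mathcal{Q}$ is the poset on $S\sqcup T$ with $x\prec y$ iff $x,y\in S$ and $x\prec_\mathcal{P}y$, or $x,y\in T$ and $x\prec_\mathcal{Q}y$, or $x\in S$ and $y\in T$. For functions $\alpha:U_\mathcal{P}\to\mathbb{C}$ and $\beta:U_\mathcal{Q}\to\mathbb{C}$, $\mu_{\mathcal{P},\mathcal{Q}}(\alpha\otimes\beta)$ is the function on $U_{\mathcal{P}\cdot\mathcal{Q}}$ given by $g\mapsto\alpha(g_S)\beta(g_T)$, where $g_S,g_T$ are the submatrices of $g$ indexed by $S$ and by $T$. *)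

theory Defs
  imports Complex_Main "HOL-Library.Indicator_Function"
begin

(* A poset on I is a reflexive relation P with partial_order_on I P, so i precedes-or-equals j
   iff (i, j) \<in> P. The field with q elements is a type 'k of class {finite, field}, q = CARD('k). *)

definition strict :: "('i \<times> 'i) set \<Rightarrow> 'i \<Rightarrow> 'i \<Rightarrow> bool" where
  "strict P i j \<longleftrightarrow> (i, j) \<in> P \<and> i \<noteq> j"

definition poset_prod :: "'i set \<Rightarrow> 'i set \<Rightarrow> ('i \<times> 'i) set \<Rightarrow> ('i \<times> 'i) set \<Rightarrow> ('i \<times> 'i) set" where
  "poset_prod S T P Q = P \<union> Q \<union> S \<times> T"

(* A matrix indexed by I is a function of two indices that vanishes off I \<times> I. *)

definition id_matrix :: "'i set \<Rightarrow> 'i \<Rightarrow> 'i \<Rightarrow> 'k::field" where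
  "id_matrix I i j = (if i \<in> I \<and> i = j then 1 else 0)"

definition submatrix :: "'i set \<Rightarrow> ('i \<Rightarrow> 'i \<Rightarrow> 'k::field) \<Rightarrow> 'i \<Rightarrow> 'i \<Rightarrow> 'k" where
  "submatrix S g i j = (if i \<in> S \<and> j \<in> S then g i j else 0)"

(* The underlying set of the pattern group. *)

definition pattern_group :: "'i set \<Rightarrow> ('i \<times> 'i) set \<Rightarrow> ('i \<Rightarrow> 'i \<Rightarrow> 'k::field) set" where
  "pattern_group I P =
    {g. \<exists>x. (\<forall>i j. \<not> strict P i j \<longrightarrow> x i j = 0) \<and> g = (\<lambda>i j. id_matrix I i j + x i j)}"

(* The triple (i, a, j) is the arc from i to j with label a. *)

definition set_partition ::
  "'i set \<Rightarrow> ('i \<times> 'i) set \<Rightarrow> ('i \<times> 'k::field \<times> 'i) set \<Rightarrow> bool" where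
  "set_partition I P \<eta> \<longleftrightarrow>
    \<eta> \<subseteq> I \<times> (UNIV - {0}) \<times> I \<and>
    (\<forall>i j a b. (i, a, j) \<in> \<eta> \<and> (i, b, j) \<in> \<eta> \<longrightarrow> a = b) \<and>
    (\<forall>i a j. (i, a, j) \<in> \<eta> \<longrightarrow> strict P i j) \<and>
    (\<forall>i a j k. (i, a, j) \<in> \<eta> \<and> strict P i k \<and> strict P k j \<longrightarrow>
       (\<forall>b. (i, b, k) \<notin> \<eta> \<and> (k, b, j) \<notin> \<eta>))"

definition nonnesting :: "('i \<times> 'i) set \<Rightarrow> ('i \<times> 'k::field \<times> 'i) set \<Rightarrow> bool" where
  "nonnesting P \<eta> \<longleftrightarrow>
    \<not> (\<exists>i a j k b l. (i, a, j) \<in> \<eta> \<and> (k, b, l) \<in> \<eta> \<and>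
         strict P i k \<and> strict P k l \<and> strict P l j)"

definition NN :: "'i set \<Rightarrow> ('i \<times> 'i) set \<Rightarrow> ('i \<times> 'k::field \<times> 'i) set set" where
  "NN I P = {\<eta>. set_partition I P \<eta> \<and> nonnesting P \<eta>}"

definition restrict_arcs :: "('i \<times> 'k \<times> 'i) set \<Rightarrow> 'i set \<Rightarrow> ('i \<times> 'k \<times> 'i) set" where
  "restrict_arcs \<eta> S = {(i, a, j). (i, a, j) \<in> \<eta> \<and> i \<in> S \<and> j \<in> S}"

definition sml :: "('i \<times> 'i) set \<Rightarrow> ('i \<Rightarrow> 'i \<Rightarrow> 'k::field) \<Rightarrow> ('i \<times> 'k \<times> 'i) set" where
  "sml P g = {(i, g i j, j) | i j. strict P i j \<and> g i j \<noteq> 0 \<and>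
     (\<forall>k l. (k, l) \<noteq> (i, j) \<and> (i, k) \<in> P \<and> strict P k l \<and> (l, j) \<in> P \<longrightarrow> g k l = 0)}"

definition K :: "'i set \<Rightarrow> ('i \<times> 'i) set \<Rightarrow> ('i \<times> 'k::field \<times> 'i) set \<Rightarrow> ('i \<Rightarrow> 'i \<Rightarrow> 'k) set" where
  "K I P \<eta> = {g \<in> pattern_group I P. sml P g = \<eta>}"

(* A complex function on a pattern group is a total function on matrices, of which only the
   values on the pattern group matter. *)

definition kappa ::
  "'i set \<Rightarrow> ('i \<times> 'i) set \<Rightarrow> ('i \<times> 'k::field \<times> 'i) set \<Rightarrow> ('i \<Rightarrow> 'i \<Rightarrow> 'k) \<Rightarrow> complex" where
  "kappa I P \<eta> = indicator (K I P \<eta>)"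

(* The image under mu of the pure tensor of \<alpha> and \<beta>. *)

definition mu ::
  "'i set \<Rightarrow> 'i set \<Rightarrow> (('i \<Rightarrow> 'i \<Rightarrow> 'k::field) \<Rightarrow> complex) \<Rightarrow> (('i \<Rightarrow> 'i \<Rightarrow> 'k) \<Rightarrow> complex) \<Rightarrow>
    ('i \<Rightarrow> 'i \<Rightarrow> 'k) \<Rightarrow> complex" where
  "mu S T \<alpha> \<beta> g = \<alpha> (submatrix S g) * \<beta> (submatrix T g)"

lemma strict_poset_prod:
  assumes "partial_order_on S P" "partial_order_on T Q" "S \<inter> T = {}"
  shows "strict (poset_prod S T P Q) x y \<longleftrightarrow>
    x \<in> S \<and> y \<in> S \<and> strict P x y \<or> x \<in> T \<and> y \<in> T \<and> strict Q x y \<or> x \<in> S \<and> y \<in> T"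
  using assms partial_order_onD(4) unfolding strict_def poset_prod_def by fast

lemma partial_order_on_poset_prod:
  assumes "partial_order_on S P" "partial_order_on T Q" "S \<inter> T = {}"
  shows "partial_order_on (S \<union> T) (poset_prod S T P Q)"
proof -
  note P = partial_order_onD[OF assms(1)] and Q = partial_order_onD[OF assms(2)]
  have "refl_on (S \<union> T) (poset_prod S T P Q)"
    using P(1) Q(1) by (auto simp: refl_on_def poset_prod_def)
  moreover have "trans (poset_prod S T P Q)"
    using P(2,4) Q(2,4) assms(3) unfolding trans_def poset_prod_def by blast
  moreover have "antisym (poset_prod S T P Q)"
    using P(3,4) Q(3,4) assms(3) unfolding antisym_def poset_prod_def by blast
  moreover have "poset_prod S T P Q \<subseteq> (S \<union> T) \<times> (S \<union> T)"
    using P(4) Q(4) unfolding poset_prod_def by blast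
  ultimately show ?thesis
    by (simp add: partial_order_on_def preorder_on_def)
qed

lemma finite_NN:
  assumes "finite I"
  shows "finite (NN I P :: ('i \<times> 'k::{finite,field} \<times> 'i) set set)"
proof (rule finite_subset)
  show "NN I P \<subseteq> Pow (I \<times> (UNIV :: 'k set) \<times> I)"
    unfolding NN_def set_partition_def by blast
  show "finite (Pow (I \<times> (UNIV :: 'k set) \<times> I))"
    using assms by simp
qed

lemma sml_in_NN:
  assumes "partial_order_on I P"
  shows "sml P g \<in> NN I P"
proof -
  note P = partial_order_onD[OF assms]
  have mem: "(i, a, j) \<in> sml P g \<longleftrightarrow> a = g i j \<and> strict P i j \<and> g i j \<noteq> 0 \<and>
     (\<forall>k l. (k, l) \<noteq> (i, j) \<and> (i, k) \<in> P \<and> strict P k l \<and> (l, j) \<in> P \<longrightarrow> g k l = 0)" for i a j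
    unfolding sml_def by blast
  have sub: "i \<in> I \<and> j \<in> I \<and> (i, i) \<in> P \<and> (j, j) \<in> P" if "strict P i j" for i j
    using that P(1,4) unfolding strict_def refl_on_def by blast
  have "sml P g \<subseteq> I \<times> (UNIV - {0}) \<times> I"
    using sub mem by force
  moreover have "\<forall>i a j k. (i, a, j) \<in> sml P g \<and> strict P i k \<and> strict P k j \<longrightarrow>
       (\<forall>b. (i, b, k) \<notin> sml P g \<and> (k, b, j) \<notin> sml P g)"
    unfolding mem using sub by (metis prod.inject strict_def)
  moreover have "nonnesting P (sml P g)"
    unfolding nonnesting_def mem by (metis prod.inject strict_def)
  ultimately show ?thesis
    unfolding NN_def set_partition_def using mem by auto
qed

lemma submatrix_in_pattern_group:
  assumes "partial_order_on S P" "partial_order_on T Q" "S \<inter> T = {}"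
    and "g \<in> pattern_group (S \<union> T) (poset_prod S T P Q)"
  shows "submatrix S g \<in> pattern_group S P" and "submatrix T g \<in> pattern_group T Q"
proof -
  obtain x where x: "\<And>i j. \<not> strict (poset_prod S T P Q) i j \<Longrightarrow> x i j = 0"
    and g: "g = (\<lambda>i j. id_matrix (S \<union> T) i j + x i j)"
    using assms(4) unfolding pattern_group_def by auto
  have "\<forall>i j. \<not> strict P i j \<longrightarrow> submatrix S x i j = 0"
    "\<forall>i j. \<not> strict Q i j \<longrightarrow> submatrix T x i j = 0"
    using x strict_poset_prod[OF assms(1-3)] assms(3) unfolding submatrix_def by (metis disjoint_iff)+
  moreover have "submatrix S g = (\<lambda>i j. id_matrix S i j + submatrix S x i j)"
    "submatrix T g = (\<lambda>i j. id_matrix T i j + submatrix T x i j)"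
    unfolding g by (auto simp: fun_eq_iff submatrix_def id_matrix_def)
  ultimately show "submatrix S g \<in> pattern_group S P" "submatrix T g \<in> pattern_group T Q"
    unfolding pattern_group_def by blast+
qed

end

(* Both S and T are convex in P . Q, so every interval between two elements of S (or of T) lies
   inside that part. As sml reads an arc i - j off the interval from i to j, restricting sml g to a
   part is the same as taking sml of the corresponding submatrix. So for given g exactly one
   partition, sml g, can contribute to the sum, and it does iff sml g_S and sml g_T are the given
   partitions. *)
theory Submission
  imports Defs
begin

text \<open>Stated for an arbitrary convex set \<open>A\<close>, so that one argument covers both
  factors of the product.\<close>

lemma restrict_arcs_sml:
  assumes "trans R" and P: "P = R \<inter> A \<times> A"
    and convex: "\<And>i j k. i \<in> A \<Longrightarrow> j \<in> A \<Longrightarrow> (i, k) \<in> R \<Longrightarrow> (k, j) \<in> R \<Longrightarrow> k \<in> A"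
  shows "restrict_arcs (sml R g) A = sml P (submatrix A g)"
proof -
  \<comment> \<open>Transitivity gives \<open>(k, j) \<in> R\<close> and
    \<open>(i, l) \<in> R\<close>, so convexity puts both \<open>k\<close> and \<open>l\<close> in
    \<open>A\<close>.\<close>
  have interval: "(i, k) \<in> R \<and> strict R k l \<and> (l, j) \<in> R \<longleftrightarrow>
      (i, k) \<in> P \<and> strict P k l \<and> (l, j) \<in> P" if "i \<in> A" "j \<in> A" for i j k l
    using that convex transD[OF \<open>trans R\<close>] unfolding strict_def P by blast
  have "(i, a, j) \<in> restrict_arcs (sml R g) A \<longleftrightarrow> (i, a, j) \<in> sml P (submatrix A g)" for i a j
  proof (cases "i \<in> A \<and> j \<in> A")
    case True
    then have arc: "strict P i j \<longleftrightarrow> strict R i j" and entry: "submatrix A g i j = g i j"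
      unfolding strict_def P submatrix_def by auto
    have "(\<forall>k l. (k, l) \<noteq> (i, j) \<and> (i, k) \<in> R \<and> strict R k l \<and> (l, j) \<in> R \<longrightarrow> g k l = 0) \<longleftrightarrow>
        (\<forall>k l. (k, l) \<noteq> (i, j) \<and> (i, k) \<in> P \<and> strict P k l \<and> (l, j) \<in> P \<longrightarrow>
          submatrix A g k l = 0)"
      unfolding interval[OF conjunct1[OF True] conjunct2[OF True]]
      by (auto simp: P strict_def submatrix_def)
    then show ?thesis
      using True arc entry unfolding restrict_arcs_def sml_def by auto
  next
    \<comment> \<open>Neither side has such an arc: the left by restriction, the right because
      \<open>P\<close> lies in \<open>A \<times> A\<close>.\<close>
    case False
    then show ?thesis
      unfolding restrict_arcs_def sml_def strict_def P by auto
  qed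
  then show ?thesis
    by auto
qed

text \<open>Convexity holds because the only relations between the parts go from \<open>S\<close> up
  to \<open>T\<close>: whatever lies below an element of \<open>S\<close> is in \<open>S\<close>,
  and whatever lies above an element of \<open>T\<close> is in \<open>T\<close>.\<close>

lemma restrict_arcs_sml_poset_prod:
  assumes "partial_order_on S P" "partial_order_on T Q" "S \<inter> T = {}"
  shows "restrict_arcs (sml (poset_prod S T P Q) g) S = sml P (submatrix S g)"
    and "restrict_arcs (sml (poset_prod S T P Q) g) T = sml Q (submatrix T g)"
proof -
  note PQ = partial_order_onD(4)[OF assms(1)] partial_order_onD(4)[OF assms(2)]
  have "trans (poset_prod S T P Q)"
    using partial_order_onD(2)[OF partial_order_on_poset_prod[OF assms]] .
  note * = restrict_arcs_sml[OF this]
  show "restrict_arcs (sml (poset_prod S T P Q) g) S = sml P (submatrix S g)"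
    by (rule *) (use PQ assms(3) in \<open>auto simp: poset_prod_def\<close>)
  show "restrict_arcs (sml (poset_prod S T P Q) g) T = sml Q (submatrix T g)"
    by (rule *) (use PQ assms(3) in \<open>auto simp: poset_prod_def\<close>)
qed

theorem proposition8p3:
  fixes S T :: "'i set" and P Q :: "('i \<times> 'i) set"
    and \<eta> \<nu> :: "('i \<times> 'k::{finite,field} \<times> 'i) set"
  assumes "finite S" and "finite T" and "S \<inter> T = {}"
    and "partial_order_on S P" and "partial_order_on T Q"
    and "\<eta> \<in> NN S P" and "\<nu> \<in> NN T Q"
  shows "\<forall>g \<in> pattern_group (S \<union> T) (poset_prod S T P Q).
    mu S T (kappa S P \<eta>) (kappa T Q \<nu>) g =
    (\<Sum>\<rho> \<in> {\<rho> \<in> NN (S \<union> T) (poset_prod S T P Q). restrict_arcs \<rho> S = \<eta> \<and> restrict_arcs \<rho> T = \<nu>}.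
       kappa (S \<union> T) (poset_prod S T P Q) \<rho> g)"
proof
  fix g :: "'i \<Rightarrow> 'i \<Rightarrow> 'k"
  let ?R = "poset_prod S T P Q"
  let ?N = "{\<rho> \<in> NN (S \<union> T) ?R. restrict_arcs \<rho> S = \<eta> \<and> restrict_arcs \<rho> T = \<nu>}"
  assume g: "g \<in> pattern_group (S \<union> T) ?R"
  note PQ = assms(4,5,3)
  have "finite ?N"
    using assms(1,2) by (intro finite_subset[OF Collect_restrict] finite_NN) simp
  have "(\<Sum>\<rho>\<in>?N. kappa (S \<union> T) ?R \<rho> g) = (\<Sum>\<rho>\<in>?N. if sml ?R g = \<rho> then 1 else 0)"
    using g by (intro sum.cong refl) (simp add: kappa_def K_def indicator_def)
  also have "\<dots> = (if sml ?R g \<in> ?N then 1 else 0)"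
    using \<open>finite ?N\<close> by (rule sum.delta')
  \<comment> \<open>Since \<open>sml ?R g\<close> is always in \<open>NN\<close>, membership in
    \<open>?N\<close> amounts to the two restriction conditions. The submatrices lie in their
    pattern groups, so each factor of \<open>mu\<close> is the indicator of one of these
    conditions.\<close>
  also have "\<dots> = mu S T (kappa S P \<eta>) (kappa T Q \<nu>) g"
    using sml_in_NN[OF partial_order_on_poset_prod[OF PQ], of g]
      submatrix_in_pattern_group[OF PQ g] restrict_arcs_sml_poset_prod[OF PQ, of g]
    by (simp add: mu_def kappa_def K_def indicator_def)
  finally show "mu S T (kappa S P \<eta>) (kappa T Q \<nu>) g = (\<Sum>\<rho>\<in>?N. kappa (S \<union> T) ?R \<rho> g)"
    by (rule sym)
qed

end
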